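(* For every $n\ge 1$, every edge 2-coloring of the complete graph $K_n$ has a color group of size at least $\left\lceil \frac{n(n-1)}{6}\right\rceil$; that is, $\mathrm{OPT}(K_n)\ge \left\lceil \frac{1}{3}|E(K_n)|\right\rceil=\left\lceil \frac{n(n-1)}{6}\right\rceil$.
   Context: An edge 2-coloring of a graph is an assignment of colors to its edges such that each vertex is incident to edges of at most 2 distinct colors. A color group is the set of all edges receiving a given color. $\mathrm{OPT}(G)$ denotes the minimum, over all edge 2-colorings of $G$, of the size of the largest color group. *)

theory Defs
  imports Complex_Main
begin

text \<open>A graph is a pair of a vertex set and a set of edges, the edges being 2-element vertex sets.\<close>

type_synonym 'v graph = "'v set \<times> 'v set set"

abbreviation verts :: "'v graph \<Rightarrow> 'v set" where
  "verts \<equiv> fst"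

abbreviation edges :: "'v graph \<Rightarrow> 'v set set" where
  "edges \<equiv> snd"

definition complete_graph :: "'v set \<Rightarrow> 'v graph" where
  "complete_graph V = (V, {e. e \<subseteq> V \<and> card e = 2})"

definition edge_2_coloring :: "'v graph \<Rightarrow> ('v set \<Rightarrow> 'c) \<Rightarrow> bool" where
  "edge_2_coloring G c \<longleftrightarrow>
     (\<forall>v \<in> verts G. finite (c ` {e \<in> edges G. v \<in> e}) \<and> card (c ` {e \<in> edges G. v \<in> e}) \<le> 2)"

definition color_group :: "'v graph \<Rightarrow> ('v set \<Rightarrow> 'c) \<Rightarrow> 'c \<Rightarrow> 'v set set" where
  "color_group G c k = {e \<in> edges G. c e = k}"

text \<open>The maximum ranges over all colors, used or not, so that it is taken over a nonempty set even
  for an edgeless graph, where it is 0. It is meaningful for graphs with finitely many edges.\<close>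

definition largest_group_size :: "'v graph \<Rightarrow> ('v set \<Rightarrow> 'c) \<Rightarrow> nat" where
  "largest_group_size G c = Max (range (\<lambda>k. card (color_group G c k)))"

text \<open>Natural numbers suffice as colors, since a coloring of a finite graph uses only finitely many.
  The infimum is a minimum: it is over a set of naturals, nonempty because a constant coloring is
  an edge 2-coloring.\<close>

definition OPT :: "'v graph \<Rightarrow> nat" where
  "OPT G = Inf {largest_group_size G c | c :: 'v set \<Rightarrow> nat. edge_2_coloring G c}"

end

theory Submission
  imports Defs
begin

text \<open>Any two vertices of \<open>K\<^sub>n\<close> share the color of the edge between them, so the color sets of the
  vertices form a pairwise intersecting family of sets of size at most 2: either at most three colors
  occur altogether and the pigeonhole principle applies, or some color \<open>a\<close> is seen by every vertex.
  In the latter case the vertex sets \<open>V\<^sub>i\<close> seeing the colors \<open>i \<noteq> a\<close> are disjoint. If no such color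
  occurs on more than a third of the edges, then it occurs on at most \<open>|V\<^sub>i| (n - 1) / 3\<close> edges;
  summing over \<open>i\<close>, these colors take at most two thirds of the edges, and the rest has color \<open>a\<close>.\<close>

text \<open>Without a common element every member is a pair. Two members \<open>{a, b}\<close> and
  \<open>{b, d}\<close> share \<open>b\<close>, and a member avoiding \<open>b\<close> has to be
  \<open>{a, d}\<close>. The three sides of this triangle leave no room for an element outside
  \<open>{a, b, d}\<close>.\<close>

lemma intersecting_pairs_star_or_triangle:
  fixes F :: "'a set set"
  assumes sub: "\<And>A. A \<in> F \<Longrightarrow> finite A \<and> card A \<le> 2"
    and int: "\<And>A B. A \<in> F \<Longrightarrow> B \<in> F \<Longrightarrow> A \<inter> B \<noteq> {}"
    and "F \<noteq> {}"
  obtains a where "\<And>A. A \<in> F \<Longrightarrow> a \<in> A" | T where "finite T" "card T \<le> 3" "\<Union>F \<subseteq> T"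
proof (cases "\<exists>a. \<forall>A \<in> F. a \<in> A")
  case True
  then show ?thesis using that(1) by blast
next
  case False
  \<comment> \<open>Some member avoids \<open>x\<close>, and \<open>A\<close> meets it in a second
    element \<open>y\<close>; the size bound then leaves nothing else in \<open>A\<close>.\<close>
  have pair: "\<exists>y. y \<noteq> x \<and> A = {x, y}" if "A \<in> F" "x \<in> A" for A x
  proof -
    obtain B where "B \<in> F" "x \<notin> B" using False by blast
    then obtain y where y: "y \<in> A" "y \<noteq> x" using int[OF \<open>A \<in> F\<close>] by blast
    have "{x, y} = A"
      using sub[OF \<open>A \<in> F\<close>] y that(2) by (intro card_seteq) auto
    with y show ?thesis by blast
  qed
  obtain A a where "A \<in> F" "a \<in> A" using \<open>F \<noteq> {}\<close> int by fast
  then obtain b where ab: "{a, b} \<in> F" "a \<noteq> b" using pair by metis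
  obtain B where B: "B \<in> F" "a \<notin> B" using False by blast
  then have "b \<in> B" using int[OF ab(1) B(1)] by blast
  then obtain d where bd: "{b, d} \<in> F" "a \<noteq> d" "b \<noteq> d" using pair B by fastforce
  obtain D where D: "D \<in> F" "b \<notin> D" using False by blast
  have "a \<in> D" "d \<in> D" using int[OF ab(1) D(1)] int[OF bd(1) D(1)] D(2) by auto
  then have ad: "{a, d} \<in> F" using pair[OF D(1)] D(1) bd(2) by fastforce
  have "C \<subseteq> {a, b, d}" if C: "C \<in> F" for C
  proof -
    \<comment> \<open>Meeting all three sides forces two of the corners into \<open>C\<close>, which
      has only two elements.\<close>
    have meets: "a \<in> C \<or> b \<in> C" "b \<in> C \<or> d \<in> C" "a \<in> C \<or> d \<in> C"
      using int[OF C ab(1)] int[OF C bd(1)] int[OF C ad] by auto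
    then obtain x where x: "x \<in> C" "x \<in> {a, b, d}" by blast
    then show ?thesis using pair[OF C x(1)] meets ab(2) bd(2,3) by auto
  qed
  then have "\<Union>F \<subseteq> {a, b, d}" by blast
  moreover have "card {a, b, d} \<le> 3" by (simp add: card_insert_if)
  ultimately show ?thesis using that(2)[of "{a, b, d}"] by blast
qed

lemma two_times_choose_two: "2 * (n choose 2) = n * (n - 1)"
  by (cases n) (simp_all add: choose_two)

text \<open>The hypotheses bound \<open>6 * m\<close> by \<open>3 * k * (k - 1)\<close> and by
  \<open>n * (n - 1)\<close>. The first bound suffices while \<open>k - 1\<close> is at most two
  thirds of \<open>n - 1\<close>; for larger \<open>k\<close> one has \<open>n \<le> 2 * k\<close>,
  and the second suffices. The conclusion is linear in \<open>k\<close> so that it can be summed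
  over disjoint vertex sets.\<close>

lemma three_times_le_if_le_choose_two:
  fixes k m n :: nat
  assumes "m \<le> k choose 2" "3 * m \<le> n choose 2" "k \<le> n"
  shows "3 * m \<le> k * (n - 1)"
proof (cases "3 * (k - 1) \<le> 2 * (n - 1)")
  case True
  have "2 * (3 * m) \<le> k * (3 * (k - 1))"
    using assms(1) two_times_choose_two[of k] by (simp add: algebra_simps)
  also have "\<dots> \<le> k * (2 * (n - 1))" using True by (rule mult_le_mono2)
  finally show ?thesis by simp
next
  case False
  then have "n \<le> 2 * k" by simp
  have "2 * (3 * m) \<le> n * (n - 1)" using assms(2) two_times_choose_two[of n] by simp
  also have "\<dots> \<le> (2 * k) * (n - 1)" using \<open>n \<le> 2 * k\<close> by (rule mult_le_mono1)
  finally show ?thesis by simp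
qed

lemma finite_edges_complete_graph [simp]: "finite V \<Longrightarrow> finite (edges (complete_graph V))"
  by (simp add: complete_graph_def)

lemma card_edges_complete_graph:
  "finite V \<Longrightarrow> card (edges (complete_graph V)) = card V choose 2"
  by (simp add: complete_graph_def n_subsets)

text \<open>\<open>K\<close> may contain colors that occur on no edge: their groups are empty and
  contribute 0.\<close>

lemma card_edges_eq_sum_color_groups:
  assumes "finite (edges G)" "finite K" "c ` edges G \<subseteq> K"
  shows "card (edges G) = (\<Sum>k\<in>K. card (color_group G c k))"
proof -
  have "edges G = (\<Union>k\<in>K. color_group G c k)" using assms(3) by (auto simp: color_group_def)
  also have "card \<dots> = (\<Sum>k\<in>K. card (color_group G c k))"
    using assms(1,2) by (intro card_UN_disjoint) (auto simp: color_group_def)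
  finally show ?thesis .
qed

definition colors_at :: "'v graph \<Rightarrow> ('v set \<Rightarrow> 'c) \<Rightarrow> 'v \<Rightarrow> 'c set" where
  "colors_at G c v = c ` {e \<in> edges G. v \<in> e}"

lemma color_group_third_if_common_color:
  fixes V :: "'v set" and c :: "'v set \<Rightarrow> 'c"
  assumes V: "finite V" and c: "edge_2_coloring (complete_graph V) c"
    and a: "\<And>v. v \<in> V \<Longrightarrow> a \<in> colors_at (complete_graph V) c v"
  shows "\<exists>k. card (edges (complete_graph V)) \<le> 3 * card (color_group (complete_graph V) c k)"
proof (rule ccontr)
  define G where "G = complete_graph V"
  define m where "m k = card (color_group G c k)" for k
  define W where "W k = {v \<in> V. k \<in> colors_at G c v}" for k
  define K where "K = c ` edges G - {a}"
  let ?n = "card V"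
  assume "\<not> ?thesis"
  then have small: "3 * m k < card (edges G)" for k
    by (auto simp: m_def G_def not_le)
  have E: "card (edges G) = ?n choose 2"
    using V by (simp add: G_def card_edges_complete_graph)
  have finE: "finite (edges G)" using V by (simp add: G_def)
  have finK: "finite K" using finE by (simp add: K_def)
  have finW: "finite (W k)" for k using V by (simp add: W_def)
  \<comment> \<open>Both ends of an edge of color \<open>k\<close> see \<open>k\<close>, so the
    color group lies inside the complete graph on \<open>W k\<close>.\<close>
  have m_le: "3 * m k \<le> card (W k) * (?n - 1)" for k
  proof (rule three_times_le_if_le_choose_two)
    have "color_group G c k \<subseteq> {e. e \<subseteq> W k \<and> card e = 2}"
      by (auto simp: color_group_def G_def complete_graph_def W_def colors_at_def)
    then have "m k \<le> card {e. e \<subseteq> W k \<and> card e = 2}"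
      unfolding m_def using finW by (intro card_mono) auto
    then show "m k \<le> card (W k) choose 2" using finW by (simp add: n_subsets)
    show "3 * m k \<le> ?n choose 2" using small[of k] E by simp
    show "card (W k) \<le> ?n" using V by (auto simp: W_def intro: card_mono)
  qed
  \<comment> \<open>A vertex in both sets would see the three distinct colors \<open>a\<close>,
    \<open>i\<close> and \<open>j\<close>.\<close>
  have disj: "W i \<inter> W j = {}" if "i \<in> K" "j \<in> K" "i \<noteq> j" for i j
  proof (rule ccontr)
    assume "W i \<inter> W j \<noteq> {}"
    then obtain v where v: "v \<in> V" "{a, i, j} \<subseteq> colors_at G c v"
      using a by (auto simp: W_def G_def)
    have "finite (colors_at G c v)" "card (colors_at G c v) \<le> 2"
      using c v(1) by (auto simp: edge_2_coloring_def colors_at_def G_def complete_graph_def)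
    then have "card {a, i, j} \<le> 2" using card_mono v(2) le_trans by metis
    then show False using that by (auto simp: K_def card_insert_if)
  qed
  have "3 * (\<Sum>k\<in>K. m k) \<le> (\<Sum>k\<in>K. card (W k)) * (?n - 1)"
    unfolding sum_distrib_left sum_distrib_right by (rule sum_mono) (rule m_le)
  also have "(\<Sum>k\<in>K. card (W k)) = card (\<Union>k\<in>K. W k)"
    using finK finW disj by (intro card_UN_disjoint[symmetric]) auto
  also have "\<dots> * (?n - 1) \<le> ?n * (?n - 1)"
    using V by (intro mult_le_mono1 card_mono) (auto simp: W_def)
  also have "\<dots> = 2 * card (edges G)" using E two_times_choose_two by simp
  finally have "3 * (\<Sum>k\<in>K. m k) \<le> 2 * card (edges G)" .
  moreover have "card (edges G) = m a + (\<Sum>k\<in>K. m k)"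
  proof -
    have "a \<notin> K" "c ` edges G \<subseteq> insert a K" by (auto simp: K_def)
    then show ?thesis
      using card_edges_eq_sum_color_groups[OF finE, of "insert a K" c] finK by (simp add: m_def)
  qed
  \<comment> \<open>At least a third of the edges remains for color \<open>a\<close>, against the
    strict bound on its group.\<close>
  ultimately show False using small[of a] by simp
qed

lemma color_group_third_if_few_colors:
  assumes "finite (edges G)" "finite T" "card T \<le> 3" "c ` edges G \<subseteq> T"
  shows "\<exists>k. card (edges G) \<le> 3 * card (color_group G c k)"
proof (rule ccontr)
  assume "\<not> ?thesis"
  then have small: "3 * card (color_group G c k) < card (edges G)" for k
    by (auto simp: not_le)
  \<comment> \<open>The strict bound in \<open>small\<close> implies that there is an edge, and its
    color lies in \<open>T\<close>. Nonemptiness keeps the sum below strict.\<close>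
  have "T \<noteq> {}" using small assms(1,4) by fastforce
  have "3 * card (edges G) = (\<Sum>k\<in>T. 3 * card (color_group G c k))"
    using card_edges_eq_sum_color_groups[OF assms(1,2,4)] by (simp add: sum_distrib_left)
  also have "\<dots> < (\<Sum>k\<in>T. card (edges G))"
    using assms(2) \<open>T \<noteq> {}\<close> small by (intro sum_strict_mono) auto
  also have "\<dots> \<le> 3 * card (edges G)" using assms(3) by simp
  finally show False by simp
qed

lemma ex_color_group_third:
  fixes V :: "'v set" and c :: "'v set \<Rightarrow> 'c"
  assumes V: "finite V" and c: "edge_2_coloring (complete_graph V) c"
  shows "\<exists>k. card (edges (complete_graph V)) \<le> 3 * card (color_group (complete_graph V) c k)"
proof (cases "edges (complete_graph V) = {}")
  case True
  then show ?thesis by simp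
next
  case False
  define G where "G = complete_graph V"
  define S where "S = colors_at G c"
  have edge_color: "c {u, v} \<in> S u \<inter> S v" if "u \<in> V" "v \<in> V" "u \<noteq> v" for u v
    using that by (auto simp: S_def colors_at_def G_def complete_graph_def)
  obtain x y where xy: "x \<in> V" "y \<in> V" "x \<noteq> y"
    using False by (auto simp: complete_graph_def card_2_iff)
  have meet: "A \<inter> B \<noteq> {}" if AB: "A \<in> S ` V" "B \<in> S ` V" for A B
  proof -
    obtain u v where uv: "u \<in> V" "v \<in> V" "A = S u" "B = S v" using AB by blast
    \<comment> \<open>For \<open>u = v\<close> the claim is that \<open>S u\<close> is nonempty,
      which takes an edge from \<open>u\<close> to another vertex. This is why the edgeless case is
      treated separately.\<close>
    obtain w where w: "w \<in> V" "w \<noteq> u" using xy by metis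
    show ?thesis using uv w edge_color[of u v] edge_color[of u w] by (cases "u = v") auto
  qed
  have sub: "finite A \<and> card A \<le> 2" if "A \<in> S ` V" for A
    using that c by (auto simp: S_def colors_at_def G_def edge_2_coloring_def complete_graph_def)
  have "S ` V \<noteq> {}" using xy by blast
  with sub meet show ?thesis
  proof (rule intersecting_pairs_star_or_triangle)
    fix a assume "\<And>A. A \<in> S ` V \<Longrightarrow> a \<in> A"
    then show ?thesis
      using color_group_third_if_common_color[OF V c, of a] by (auto simp: S_def G_def)
  next
    fix T assume T: "finite T" "card T \<le> 3" "\<Union> (S ` V) \<subseteq> T"
    have "c ` edges G \<subseteq> \<Union> (S ` V)"
      by (fastforce simp: S_def colors_at_def G_def complete_graph_def card_2_iff)
    then show ?thesis
      using color_group_third_if_few_colors[of G T c] T V by (auto simp: G_def)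
  qed
qed

text \<open>All group sizes are at most the number of edges, so \<open>Max\<close> is taken over a
  finite set even if the color type is infinite.\<close>

lemma card_color_group_le_largest:
  assumes "finite (edges G)"
  shows "card (color_group G c k) \<le> largest_group_size G c"
proof -
  have "card (color_group G c j) \<le> card (edges G)" for j
    using assms by (auto simp: color_group_def intro: card_mono)
  then have "finite (range (\<lambda>j. card (color_group G c j)))"
    by (intro finite_subset[OF _ finite_atMost[of "card (edges G)"]]) auto
  then show ?thesis unfolding largest_group_size_def by (intro Max_ge) auto
qed

text \<open>Reduces a lower bound on \<open>OPT\<close> to a bound on the largest group of one
  optimal coloring.\<close>

lemma OPT_attained:
  obtains c :: "'v set \<Rightarrow> nat" where "edge_2_coloring G c" "OPT G = largest_group_size G c"
proof -
  let ?X = "{largest_group_size G c | c :: 'v set \<Rightarrow> nat. edge_2_coloring G c}"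
  have "edge_2_coloring G (\<lambda>_. 0 :: nat)"
    by (auto simp: edge_2_coloring_def image_constant_conv)
  then have "?X \<noteq> {}" by blast
  then have "Inf ?X \<in> ?X" by (rule Inf_nat_def1)
  then show ?thesis using that by (auto simp: OPT_def)
qed

theorem theorem4:
  fixes n :: nat and V :: "'v set"
  assumes "n \<ge> 1" and "finite V" and "card V = n"
  shows "(\<forall>c :: 'v set \<Rightarrow> 'c. edge_2_coloring (complete_graph V) c \<longrightarrow>
            (\<exists>k. int (card (color_group (complete_graph V) c k)) \<ge> \<lceil>real (n * (n - 1)) / 6\<rceil>))
       \<and> int (OPT (complete_graph V)) \<ge> \<lceil>1 / 3 * real (card (edges (complete_graph V)))\<rceil>
       \<and> \<lceil>1 / 3 * real (card (edges (complete_graph V)))\<rceil> = \<lceil>real (n * (n - 1)) / 6\<rceil>"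
proof -
  let ?G = "complete_graph V"
  have "n * (n - 1) = 2 * card (edges ?G)"
    using assms by (simp add: card_edges_complete_graph two_times_choose_two)
  then have E: "real (n * (n - 1)) / 6 = 1 / 3 * real (card (edges ?G))" by simp
  have ceil: "\<lceil>1 / 3 * real (card (edges ?G))\<rceil> \<le> int m" if "card (edges ?G) \<le> 3 * m" for m
    using that by (simp add: ceiling_le_iff)
  have "\<exists>k. \<lceil>real (n * (n - 1)) / 6\<rceil> \<le> int (card (color_group ?G c k))"
    if "edge_2_coloring ?G c" for c :: "'v set \<Rightarrow> 'c"
    unfolding E using ex_color_group_third[OF assms(2) that] ceil by blast
  \<comment> \<open>Here the polymorphic \<open>ex_color_group_third\<close> is used with natural
    numbers as colors, as in \<open>OPT\<close>, instead of the type \<open>'c\<close>.\<close>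
  moreover have "\<lceil>1 / 3 * real (card (edges ?G))\<rceil> \<le> int (OPT ?G)"
  proof -
    obtain c :: "'v set \<Rightarrow> nat" where c: "edge_2_coloring ?G c" "OPT ?G = largest_group_size ?G c"
      by (rule OPT_attained)
    obtain k where "card (edges ?G) \<le> 3 * card (color_group ?G c k)"
      using ex_color_group_third[OF assms(2) c(1)] by blast
    also have "\<dots> \<le> 3 * OPT ?G" using card_color_group_le_largest[of ?G c k] assms(2) c(2) by simp
    finally show ?thesis by (rule ceil)
  qed
  ultimately show ?thesis unfolding E by blast
qed

end
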